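(* (Fiber shrinking) Let $K$ be a Henselian valued field of equicharacteristic zero. Every $\mathcal{L}$-definable subset $A$ of $K^{n}$ with accumulation point $a \in K^{n}$ has, after a permutation of the coordinates, an $\mathcal{L}$-definable $x_{1}$-fiber shrinking at $a$.
   Context: $K$ is a Henselian valued field whose residue field $\Bbbk$ has characteristic zero, with valuation $v$, value group $\Gamma$ and valuation ring $R$. $\mathcal{L}$ is the three-sorted language of Denef--Pas: the $K$-sort carries the language of rings; the $\Gamma$-sort (with $\infty$) carries any augmentation of the language of ordered abelian groups; the $\Bbbk$-sort carries any augmentation of the language of rings; the only symbols connecting the sorts are the valuation $v: K \to \Gamma\cup\{\infty\}$ and a fixed angular component map $\overline{ac}: K \to \Bbbk$ (multiplicative on $K^{\times}$, equal to the residue map on $R^{\times}$, with $\overline{ac}(0)=0$). $\mathcal{L}$-definable means definable in this structure with parameters. Topological notions refer to the $K$-topology (induced by $v$; product topology on $K^{n}$). Definition. Let $A$ be an $\mathcal{L}$-definable subset of $K^{n}$ with accumulation point $a=(a_{1},\ldots,a_{n}) \in K^{n}$ and $E$ an $\mathcal{L}$-definable subset of $K$ with accumulation point $a_{1}$. An $\mathcal{L}$-definable family of sets $$ \Phi = \bigcup_{t \in E} \{t\} \times \Phi_{t} \subset A $$ is called an $\mathcal{L}$-definable $x_{1}$-fiber shrinking for $A$ at $a$ if $\lim_{t \to a_{1}} \Phi_{t} = (a_{2},\ldots,a_{n})$, i.e. for any neighborhood $U$ of $(a_{2},\ldots,a_{n}) \in K^{n-1}$ there is a neighborhood $V$ of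 $a_{1} \in K$ such that $\emptyset \neq \Phi_{t} \subset U$ for every $t \in V \cap E$, $t \neq a_{1}$. When $n=1$, $A$ is itself a fiber shrinking for $A$ at $a$. *)

theory Defs
  imports
    "HOL-Analysis.Abstract_Topology"
    "HOL-Analysis.Function_Topology"
    "HOL-Combinatorics.Permutations"
    "HOL-Computational_Algebra.Polynomial"
begin

section \<open>Value groups with infinity\<close>

datatype 'g with_infty = Fin 'g | Infty

instantiation with_infty :: (linorder) linorder
begin

fun less_eq_with_infty :: "'a with_infty \<Rightarrow> 'a with_infty \<Rightarrow> bool" where
  "less_eq_with_infty _ Infty = True"
| "less_eq_with_infty (Fin x) (Fin y) = (x \<le> y)"
| "less_eq_with_infty Infty (Fin _) = False"

definition less_with_infty :: "'a with_infty \<Rightarrow> 'a with_infty \<Rightarrow> bool" where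
  "less_with_infty x y \<longleftrightarrow> x \<le> y \<and> \<not> y \<le> x"

instance
proof
  fix x y z :: "'a with_infty"
  show "x < y \<longleftrightarrow> x \<le> y \<and> \<not> y \<le> x" by (rule less_with_infty_def)
  show "x \<le> x" by (cases x) auto
  show "x \<le> y \<Longrightarrow> y \<le> z \<Longrightarrow> x \<le> z" by (cases x; cases y; cases z) auto
  show "x \<le> y \<Longrightarrow> y \<le> x \<Longrightarrow> x = y" by (cases x; cases y) auto
  show "x \<le> y \<or> y \<le> x" by (cases x; cases y) auto
qed

end

lemma less_with_infty_simps [simp]:
  "Fin x < Fin y \<longleftrightarrow> x < y" "Fin x < Infty" "\<not> Infty < a"
  by (auto simp: less_with_infty_def; cases a; auto)+

instantiation with_infty :: (comm_monoid_add) comm_monoid_add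
begin

definition zero_with_infty :: "'a with_infty" where
  "0 = Fin 0"

fun plus_with_infty :: "'a with_infty \<Rightarrow> 'a with_infty \<Rightarrow> 'a with_infty" where
  "plus_with_infty (Fin x) (Fin y) = Fin (x + y)"
| "plus_with_infty Infty _ = Infty"
| "plus_with_infty _ Infty = Infty"

instance
proof
  fix x y z :: "'a with_infty"
  show "x + y + z = x + (y + z)" by (cases x; cases y; cases z) (auto simp: add.assoc)
  show "x + y = y + x" by (cases x; cases y) (auto simp: add.commute)
  show "0 + x = x" by (cases x) (auto simp: zero_with_infty_def)
qed

end

text \<open>The group inverse is made total by the convention that the inverse of infinity is infinity.\<close>

instantiation with_infty :: (uminus) uminus
begin

fun uminus_with_infty :: "'a with_infty \<Rightarrow> 'a with_infty" where
  "uminus_with_infty (Fin x) = Fin (- x)"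
| "uminus_with_infty Infty = Infty"

instance ..

end

section \<open>Henselian valued fields with an angular component map\<close>

definition valuation_ring ::
  "('k::field \<Rightarrow> 'g::linordered_ab_group_add with_infty) \<Rightarrow> 'k set" where
  "valuation_ring v = {x. 0 \<le> v x}"

text \<open>
  The residue field is given as a type \<open>'r\<close> together with a surjective ring homomorphism from the
  valuation ring whose kernel is the maximal ideal. Values of \<open>res\<close> outside the valuation ring are
  irrelevant.
\<close>

locale valued_field =
  fixes v :: "'k::field \<Rightarrow> 'g::linordered_ab_group_add with_infty"
    and res :: "'k \<Rightarrow> 'r::field"
  assumes v_eq_Infty: "v x = Infty \<longleftrightarrow> x = 0"
    and v_mult: "v (x * y) = v x + v y"
    and v_add: "min (v x) (v y) \<le> v (x + y)"
    and v_surj: "\<exists>x. v x = Fin \<gamma>"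
    and res_one: "res 1 = 1"
    and res_add: "x \<in> valuation_ring v \<Longrightarrow> y \<in> valuation_ring v \<Longrightarrow> res (x + y) = res x + res y"
    and res_mult: "x \<in> valuation_ring v \<Longrightarrow> y \<in> valuation_ring v \<Longrightarrow> res (x * y) = res x * res y"
    and res_surj: "res ` valuation_ring v = UNIV"
    and res_kernel: "x \<in> valuation_ring v \<Longrightarrow> res x = 0 \<longleftrightarrow> 0 < v x"

locale henselian_valued_field = valued_field v res
  for v :: "'k::field \<Rightarrow> 'g::linordered_ab_group_add with_infty" and res :: "'k \<Rightarrow> 'r::field" +
  assumes hensel:
    "(\<forall>i. coeff f i \<in> valuation_ring v) \<Longrightarrow> a \<in> valuation_ring v \<Longrightarrow>
      res (poly f a) = 0 \<Longrightarrow> res (poly (pderiv f) a) \<noteq> 0 \<Longrightarrow>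
      \<exists>b \<in> valuation_ring v. poly f b = 0 \<and> res b = res a"

locale angular_component =
  fixes v :: "'k::field \<Rightarrow> 'g::linordered_ab_group_add with_infty"
    and res ac :: "'k \<Rightarrow> 'r::field"
  assumes ac_zero: "ac 0 = 0"
    and ac_mult: "x \<noteq> 0 \<Longrightarrow> y \<noteq> 0 \<Longrightarrow> ac (x * y) = ac x * ac y"
    and ac_unit: "v x = 0 \<Longrightarrow> ac x = res x"

section \<open>The topology induced by the valuation\<close>

definition val_topology ::
  "('k::field \<Rightarrow> 'g::linordered_ab_group_add with_infty) \<Rightarrow> 'k topology" where
  "val_topology v = topology (\<lambda>U. \<forall>x\<in>U. \<exists>\<gamma>. {y. Fin \<gamma> < v (y - x)} \<subseteq> U)"

lemma openin_val_topology:
  "openin (val_topology v) U \<longleftrightarrow> (\<forall>x\<in>U. \<exists>\<gamma>. {y. Fin \<gamma> < v (y - x)} \<subseteq> U)"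
proof -
  let ?P = "\<lambda>U. \<forall>x\<in>U. \<exists>\<gamma>. {y. Fin \<gamma> < v (y - x)} \<subseteq> U"
  have "?P (S \<inter> T)" if S: "?P S" and T: "?P T" for S T
  proof
    fix x assume x: "x \<in> S \<inter> T"
    obtain \<gamma> where \<gamma>: "{y. Fin \<gamma> < v (y - x)} \<subseteq> S" using S x by blast
    obtain \<delta> where \<delta>: "{y. Fin \<delta> < v (y - x)} \<subseteq> T" using T x by blast
    have "Fin \<gamma> < z \<and> Fin \<delta> < z" if "Fin (max \<gamma> \<delta>) < z" for z
      using that by (cases z) auto
    then show "\<exists>\<gamma>. {y. Fin \<gamma> < v (y - x)} \<subseteq> S \<inter> T"
      using \<gamma> \<delta> by (intro exI[of _ "max \<gamma> \<delta>"]) blast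
  qed
  moreover have "?P (\<Union>\<K>)" if "\<forall>K\<in>\<K>. ?P K" for \<K>
    using that by (meson Sup_upper UnionE order_trans)
  ultimately have "istopology ?P"
    unfolding istopology_def by blast
  then show ?thesis
    by (simp add: val_topology_def topology_inverse')
qed

text \<open>
  \<open>K\<^sup>I\<close> consists of the extensional functions on \<open>I\<close>; in particular \<open>K\<^sup>n\<close> is \<open>K\<^sup>I\<close> for
  \<open>I = {1..n}\<close>, and the space of the last \<open>n - 1\<close> coordinates is \<open>K\<^sup>I\<close> for \<open>I = {2..n}\<close>.
\<close>

abbreviation affine_topology ::
  "('k::field \<Rightarrow> 'g::linordered_ab_group_add with_infty) \<Rightarrow> nat set \<Rightarrow> (nat \<Rightarrow> 'k) topology" where
  "affine_topology v I \<equiv> product_topology (\<lambda>_. val_topology v) I"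

section \<open>The three-sorted language of Denef and Pas\<close>

text \<open>
  The additional symbols on one of the auxiliary sorts, with their interpretation. A pair \<open>(f, m)\<close> in
  \<open>fun_syms\<close> stands for a function symbol of arity \<open>m\<close> (a constant if \<open>m = 0\<close>), and likewise for
  relation symbols; interpretations only matter on argument lists of the right length.
\<close>

record ('f, 'p, 'a) augmentation =
  fun_syms :: "('f \<times> nat) set"
  rel_syms :: "('p \<times> nat) set"
  fun_int :: "'f \<Rightarrow> 'a list \<Rightarrow> 'a"
  rel_int :: "'p \<Rightarrow> 'a list \<Rightarrow> bool"

datatype kterm =
    KVar nat | KZero | KOne | KAdd kterm kterm | KNeg kterm | KMul kterm kterm

datatype 'f gterm =
    GVar nat | GZero | GInfty | GAdd "'f gterm" "'f gterm" | GNeg "'f gterm"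
  | GFun 'f "'f gterm list"
  | Val kterm

datatype 'h rterm =
    RVar nat | RZero | ROne | RAdd "'h rterm" "'h rterm" | RNeg "'h rterm"
  | RMul "'h rterm" "'h rterm"
  | RFun 'h "'h rterm list"
  | AC kterm

datatype ('f, 'p, 'h, 'q) formula =
    KEq kterm kterm
  | GEq "'f gterm" "'f gterm" | GLess "'f gterm" "'f gterm" | GRel 'p "'f gterm list"
  | REq "'h rterm" "'h rterm" | RRel 'q "'h rterm list"
  | Neg "('f, 'p, 'h, 'q) formula"
  | Conj "('f, 'p, 'h, 'q) formula" "('f, 'p, 'h, 'q) formula"
  | KEx nat "('f, 'p, 'h, 'q) formula"
  | GEx nat "('f, 'p, 'h, 'q) formula"
  | REx nat "('f, 'p, 'h, 'q) formula"

primrec wf_gterm :: "('f, 'p, 'a) augmentation \<Rightarrow> 'f gterm \<Rightarrow> bool" where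
  "wf_gterm LG (GVar i) = True"
| "wf_gterm LG GZero = True"
| "wf_gterm LG GInfty = True"
| "wf_gterm LG (GAdd s t) = (wf_gterm LG s \<and> wf_gterm LG t)"
| "wf_gterm LG (GNeg t) = wf_gterm LG t"
| "wf_gterm LG (GFun f ts) = ((f, length ts) \<in> fun_syms LG \<and> list_all (wf_gterm LG) ts)"
| "wf_gterm LG (Val t) = True"

primrec wf_rterm :: "('h, 'q, 'a) augmentation \<Rightarrow> 'h rterm \<Rightarrow> bool" where
  "wf_rterm LR (RVar i) = True"
| "wf_rterm LR RZero = True"
| "wf_rterm LR ROne = True"
| "wf_rterm LR (RAdd s t) = (wf_rterm LR s \<and> wf_rterm LR t)"
| "wf_rterm LR (RNeg t) = wf_rterm LR t"
| "wf_rterm LR (RMul s t) = (wf_rterm LR s \<and> wf_rterm LR t)"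
| "wf_rterm LR (RFun f ts) = ((f, length ts) \<in> fun_syms LR \<and> list_all (wf_rterm LR) ts)"
| "wf_rterm LR (AC t) = True"

primrec wf_formula ::
  "('f, 'p, 'a) augmentation \<Rightarrow> ('h, 'q, 'b) augmentation \<Rightarrow> ('f, 'p, 'h, 'q) formula \<Rightarrow> bool" where
  "wf_formula LG LR (KEq s t) = True"
| "wf_formula LG LR (GEq s t) = (wf_gterm LG s \<and> wf_gterm LG t)"
| "wf_formula LG LR (GLess s t) = (wf_gterm LG s \<and> wf_gterm LG t)"
| "wf_formula LG LR (GRel p ts) = ((p, length ts) \<in> rel_syms LG \<and> list_all (wf_gterm LG) ts)"
| "wf_formula LG LR (REq s t) = (wf_rterm LR s \<and> wf_rterm LR t)"
| "wf_formula LG LR (RRel q ts) = ((q, length ts) \<in> rel_syms LR \<and> list_all (wf_rterm LR) ts)"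
| "wf_formula LG LR (Neg \<phi>) = wf_formula LG LR \<phi>"
| "wf_formula LG LR (Conj \<phi> \<psi>) = (wf_formula LG LR \<phi> \<and> wf_formula LG LR \<psi>)"
| "wf_formula LG LR (KEx i \<phi>) = wf_formula LG LR \<phi>"
| "wf_formula LG LR (GEx i \<phi>) = wf_formula LG LR \<phi>"
| "wf_formula LG LR (REx i \<phi>) = wf_formula LG LR \<phi>"

primrec eval_kterm :: "(nat \<Rightarrow> 'k::field) \<Rightarrow> kterm \<Rightarrow> 'k" where
  "eval_kterm e (KVar i) = e i"
| "eval_kterm e KZero = 0"
| "eval_kterm e KOne = 1"
| "eval_kterm e (KAdd s t) = eval_kterm e s + eval_kterm e t"
| "eval_kterm e (KNeg t) = - eval_kterm e t"
| "eval_kterm e (KMul s t) = eval_kterm e s * eval_kterm e t"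

primrec eval_gterm ::
  "('k::field \<Rightarrow> 'g::linordered_ab_group_add with_infty) \<Rightarrow> ('f, 'p, 'g with_infty) augmentation \<Rightarrow>
    (nat \<Rightarrow> 'k) \<Rightarrow> (nat \<Rightarrow> 'g with_infty) \<Rightarrow> 'f gterm \<Rightarrow> 'g with_infty" where
  "eval_gterm v LG e eg (GVar i) = eg i"
| "eval_gterm v LG e eg GZero = 0"
| "eval_gterm v LG e eg GInfty = Infty"
| "eval_gterm v LG e eg (GAdd s t) = eval_gterm v LG e eg s + eval_gterm v LG e eg t"
| "eval_gterm v LG e eg (GNeg t) = - eval_gterm v LG e eg t"
| "eval_gterm v LG e eg (GFun f ts) = fun_int LG f (map (eval_gterm v LG e eg) ts)"
| "eval_gterm v LG e eg (Val t) = v (eval_kterm e t)"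

primrec eval_rterm ::
  "('k::field \<Rightarrow> 'r::field) \<Rightarrow> ('h, 'q, 'r) augmentation \<Rightarrow>
    (nat \<Rightarrow> 'k) \<Rightarrow> (nat \<Rightarrow> 'r) \<Rightarrow> 'h rterm \<Rightarrow> 'r" where
  "eval_rterm ac LR e er (RVar i) = er i"
| "eval_rterm ac LR e er RZero = 0"
| "eval_rterm ac LR e er ROne = 1"
| "eval_rterm ac LR e er (RAdd s t) = eval_rterm ac LR e er s + eval_rterm ac LR e er t"
| "eval_rterm ac LR e er (RNeg t) = - eval_rterm ac LR e er t"
| "eval_rterm ac LR e er (RMul s t) = eval_rterm ac LR e er s * eval_rterm ac LR e er t"
| "eval_rterm ac LR e er (RFun f ts) = fun_int LR f (map (eval_rterm ac LR e er) ts)"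
| "eval_rterm ac LR e er (AC t) = ac (eval_kterm e t)"

primrec sat ::
  "('k::field \<Rightarrow> 'g::linordered_ab_group_add with_infty) \<Rightarrow> ('k \<Rightarrow> 'r::field) \<Rightarrow>
    ('f, 'p, 'g with_infty) augmentation \<Rightarrow> ('h, 'q, 'r) augmentation \<Rightarrow>
    ('f, 'p, 'h, 'q) formula \<Rightarrow>
    (nat \<Rightarrow> 'k) \<Rightarrow> (nat \<Rightarrow> 'g with_infty) \<Rightarrow> (nat \<Rightarrow> 'r) \<Rightarrow> bool" where
  "sat v ac LG LR (KEq s t) = (\<lambda>e eg er. eval_kterm e s = eval_kterm e t)"
| "sat v ac LG LR (GEq s t) = (\<lambda>e eg er. eval_gterm v LG e eg s = eval_gterm v LG e eg t)"
| "sat v ac LG LR (GLess s t) = (\<lambda>e eg er. eval_gterm v LG e eg s < eval_gterm v LG e eg t)"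
| "sat v ac LG LR (GRel p ts) = (\<lambda>e eg er. rel_int LG p (map (eval_gterm v LG e eg) ts))"
| "sat v ac LG LR (REq s t) = (\<lambda>e eg er. eval_rterm ac LR e er s = eval_rterm ac LR e er t)"
| "sat v ac LG LR (RRel q ts) = (\<lambda>e eg er. rel_int LR q (map (eval_rterm ac LR e er) ts))"
| "sat v ac LG LR (Neg \<phi>) = (\<lambda>e eg er. \<not> sat v ac LG LR \<phi> e eg er)"
| "sat v ac LG LR (Conj \<phi> \<psi>) =
    (\<lambda>e eg er. sat v ac LG LR \<phi> e eg er \<and> sat v ac LG LR \<psi> e eg er)"
| "sat v ac LG LR (KEx i \<phi>) = (\<lambda>e eg er. \<exists>x. sat v ac LG LR \<phi> (e(i := x)) eg er)"
| "sat v ac LG LR (GEx i \<phi>) = (\<lambda>e eg er. \<exists>x. sat v ac LG LR \<phi> e (eg(i := x)) er)"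
| "sat v ac LG LR (REx i \<phi>) = (\<lambda>e eg er. \<exists>x. sat v ac LG LR \<phi> e eg (er(i := x)))"

text \<open>
  Definability with parameters of a subset of \<open>K\<^sup>I\<close>: the \<open>K\<close>-variables with index in \<open>I\<close> are the
  coordinates, and the parameters (from all three sorts) are the values that \<open>e\<close>, \<open>eg\<close>, \<open>er\<close>
  give to the remaining free variables.
\<close>

definition definable ::
  "('k::field \<Rightarrow> 'g::linordered_ab_group_add with_infty) \<Rightarrow> ('k \<Rightarrow> 'r::field) \<Rightarrow>
    ('f, 'p, 'g with_infty) augmentation \<Rightarrow> ('h, 'q, 'r) augmentation \<Rightarrow>
    nat set \<Rightarrow> (nat \<Rightarrow> 'k) set \<Rightarrow> bool" where
  "definable v ac LG LR I A \<longleftrightarrow>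
    (\<exists>\<phi> e eg er. wf_formula LG LR \<phi> \<and>
      A = {x \<in> I \<rightarrow>\<^sub>E UNIV. sat v ac LG LR \<phi> (override_on e x I) eg er})"

abbreviation definable_line ::
  "('k::field \<Rightarrow> 'g::linordered_ab_group_add with_infty) \<Rightarrow> ('k \<Rightarrow> 'r::field) \<Rightarrow>
    ('f, 'p, 'g with_infty) augmentation \<Rightarrow> ('h, 'q, 'r) augmentation \<Rightarrow> 'k set \<Rightarrow> bool" where
  "definable_line v ac LG LR E \<equiv> definable v ac LG LR {1} ((\<lambda>t. \<lambda>i\<in>{1}. t) ` E)"

section \<open>Fiber shrinkings\<close>

definition family_total :: "'k set \<Rightarrow> ('k \<Rightarrow> (nat \<Rightarrow> 'k) set) \<Rightarrow> (nat \<Rightarrow> 'k) set" where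
  "family_total E \<Phi> = (\<Union>t\<in>E. (\<lambda>y. y(1 := t)) ` \<Phi> t)"

definition fiber_limit ::
  "('k::field \<Rightarrow> 'g::linordered_ab_group_add with_infty) \<Rightarrow> nat set \<Rightarrow>
    'k set \<Rightarrow> ('k \<Rightarrow> (nat \<Rightarrow> 'k) set) \<Rightarrow> 'k \<Rightarrow> (nat \<Rightarrow> 'k) \<Rightarrow> bool" where
  "fiber_limit v J E \<Phi> c b \<longleftrightarrow>
    (\<forall>U. openin (affine_topology v J) U \<and> b \<in> U \<longrightarrow>
      (\<exists>V. openin (val_topology v) V \<and> c \<in> V \<and>
        (\<forall>t \<in> V \<inter> E. t \<noteq> c \<longrightarrow> \<Phi> t \<noteq> {} \<and> \<Phi> t \<subseteq> U)))"

definition fiber_shrinking ::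
  "('k::field \<Rightarrow> 'g::linordered_ab_group_add with_infty) \<Rightarrow> ('k \<Rightarrow> 'r::field) \<Rightarrow>
    ('f, 'p, 'g with_infty) augmentation \<Rightarrow> ('h, 'q, 'r) augmentation \<Rightarrow>
    nat \<Rightarrow> (nat \<Rightarrow> 'k) set \<Rightarrow> (nat \<Rightarrow> 'k) \<Rightarrow> 'k set \<Rightarrow> ('k \<Rightarrow> (nat \<Rightarrow> 'k) set) \<Rightarrow> bool" where
  "fiber_shrinking v ac LG LR n A a E \<Phi> \<longleftrightarrow>
    definable v ac LG LR {1..n} A \<and>
    a \<in> affine_topology v {1..n} derived_set_of A \<and>
    definable_line v ac LG LR E \<and>
    a 1 \<in> val_topology v derived_set_of E \<and>
    (\<forall>t\<in>E. \<Phi> t \<subseteq> {2..n} \<rightarrow>\<^sub>E UNIV) \<and>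
    definable v ac LG LR {1..n} (family_total E \<Phi>) \<and>
    family_total E \<Phi> \<subseteq> A \<and>
    fiber_limit v {2..n} E \<Phi> (a 1) (restrict a {2..n})"

text \<open>
  For \<open>n = 1\<close> the fibers are subsets of the one-point space \<open>K\<^sup>0\<close>, and the general definition
  already makes \<open>A\<close> itself a fiber shrinking for \<open>A\<close> at \<open>a\<close>.
\<close>

lemma fiber_shrinking_dim_one:
  assumes def: "definable v ac LG LR {1..1} A"
    and acc: "a \<in> affine_topology v {1..1} derived_set_of A"
  defines "E \<equiv> (\<lambda>x. x 1) ` A" and "\<Phi> \<equiv> \<lambda>_. {} \<rightarrow>\<^sub>E UNIV"
  shows "family_total E \<Phi> = A" and "fiber_shrinking v ac LG LR 1 A a E \<Phi>"
proof -
  have A: "A \<subseteq> {1} \<rightarrow>\<^sub>E UNIV"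
    using def by (auto simp: definable_def)
  have eq: "(\<lambda>_. undefined)(1 := x 1) = x" "(\<lambda>i\<in>{1}. x 1) = x" if "x \<in> A" for x
    using A that by (auto simp: fun_eq_iff PiE_def extensional_def subset_iff)
  show total: "family_total E \<Phi> = A"
  proof -
    have "family_total E \<Phi> = (\<lambda>x. (\<lambda>_. undefined)(1 := x 1)) ` A"
      unfolding family_total_def E_def \<Phi>_def PiE_empty_domain by blast
    also have "\<dots> = (\<lambda>x. x) ` A"
      by (rule image_cong[OF refl eq(1)])
    finally show ?thesis by simp
  qed
  have line: "(\<lambda>t. \<lambda>i\<in>{1}. t) ` E = A"
  proof -
    have "(\<lambda>t. \<lambda>i\<in>{1}. t) ` E = (\<lambda>x. \<lambda>i\<in>{1}. x 1) ` A"
      unfolding E_def image_image ..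
    also have "\<dots> = (\<lambda>x. x) ` A"
      by (rule image_cong[OF refl eq(2)])
    finally show ?thesis by simp
  qed
  have top: "topspace (val_topology v) = UNIV"
    using openin_subset[of "val_topology v" UNIV] by (auto simp: openin_val_topology)
  have a: "a \<in> {1} \<rightarrow>\<^sub>E UNIV"
    using acc by (auto simp: derived_set_of_def top)
  have "a 1 \<in> val_topology v derived_set_of E"
    unfolding in_derived_set_of
  proof (intro conjI allI impI)
    show "a 1 \<in> topspace (val_topology v)" by (simp add: top)
    fix T assume T: "a 1 \<in> T \<and> openin (val_topology v) T"
    define W where "W = {x \<in> topspace (affine_topology v {1..1}). x 1 \<in> T}"
    have W: "openin (affine_topology v {1..1}) W"
      unfolding W_def
      using T by (intro openin_continuous_map_preimage[OF continuous_map_product_projection]) auto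
    have "a \<in> W"
      using T a by (auto simp: W_def top)
    with W have "\<exists>y. y \<noteq> a \<and> y \<in> A \<and> y \<in> W"
      using acc unfolding in_derived_set_of by simp
    then obtain y where y: "y \<noteq> a" "y \<in> A" "y 1 \<in> T"
      by (auto simp: W_def)
    have "y 1 \<noteq> a 1"
    proof
      assume "y 1 = a 1"
      moreover have "y \<in> {1} \<rightarrow>\<^sub>E UNIV" using A y(2) by (rule subsetD)
      ultimately have "y = a" using a by (auto intro: PiE_ext)
      with y(1) show False by simp
    qed
    then show "\<exists>y. y \<noteq> a 1 \<and> y \<in> E \<and> y \<in> T"
      using y by (auto simp: E_def)
  qed
  moreover have "fiber_limit v {2..1} E \<Phi> (a 1) (restrict a {2..1})"
    unfolding fiber_limit_def \<Phi>_def
    by (intro allI impI exI[of _ UNIV]) (auto simp: openin_val_topology restrict_def)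
  ultimately show "fiber_shrinking v ac LG LR 1 A a E \<Phi>"
    using def acc total line by (simp add: fiber_shrinking_def \<Phi>_def)
qed

end

theory Submission
  imports Defs
begin

text \<open>
  Every point of \<open>A\<close> lies in one of the sets \<open>B\<^sub>i\<close> of those \<open>x\<close> whose \<open>i\<close>-th coordinate is farthest
  from that of \<open>a\<close>, so \<open>a\<close> is an accumulation point of some \<open>B\<^sub>i\<close>. Exchange the coordinates \<open>1\<close> and
  \<open>i\<close>. A point of \<open>B\<^sub>1\<close> other than \<open>a\<close> then has \<open>x\<^sub>1 \<noteq> a\<^sub>1\<close>, and the fibers of \<open>B\<^sub>1\<close> over \<open>t\<close> lie in
  the polydisc of radius \<open>\<bar>t - a\<^sub>1\<bar>\<close>, so \<open>B\<^sub>1\<close> over its projection is a fiber shrinking.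
\<close>

section \<open>Renaming variables\<close>

primrec rename_kterm :: "(nat \<Rightarrow> nat) \<Rightarrow> kterm \<Rightarrow> kterm" where
  "rename_kterm k (KVar i) = KVar (k i)"
| "rename_kterm k KZero = KZero"
| "rename_kterm k KOne = KOne"
| "rename_kterm k (KAdd s t) = KAdd (rename_kterm k s) (rename_kterm k t)"
| "rename_kterm k (KNeg t) = KNeg (rename_kterm k t)"
| "rename_kterm k (KMul s t) = KMul (rename_kterm k s) (rename_kterm k t)"

primrec rename_gterm :: "(nat \<Rightarrow> nat) \<Rightarrow> (nat \<Rightarrow> nat) \<Rightarrow> 'f gterm \<Rightarrow> 'f gterm" where
  "rename_gterm k g (GVar i) = GVar (g i)"
| "rename_gterm k g GZero = GZero"
| "rename_gterm k g GInfty = GInfty"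
| "rename_gterm k g (GAdd s t) = GAdd (rename_gterm k g s) (rename_gterm k g t)"
| "rename_gterm k g (GNeg t) = GNeg (rename_gterm k g t)"
| "rename_gterm k g (GFun f ts) = GFun f (map (rename_gterm k g) ts)"
| "rename_gterm k g (Val t) = Val (rename_kterm k t)"

primrec rename_rterm :: "(nat \<Rightarrow> nat) \<Rightarrow> (nat \<Rightarrow> nat) \<Rightarrow> 'h rterm \<Rightarrow> 'h rterm" where
  "rename_rterm k r (RVar i) = RVar (r i)"
| "rename_rterm k r RZero = RZero"
| "rename_rterm k r ROne = ROne"
| "rename_rterm k r (RAdd s t) = RAdd (rename_rterm k r s) (rename_rterm k r t)"
| "rename_rterm k r (RNeg t) = RNeg (rename_rterm k r t)"
| "rename_rterm k r (RMul s t) = RMul (rename_rterm k r s) (rename_rterm k r t)"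
| "rename_rterm k r (RFun f ts) = RFun f (map (rename_rterm k r) ts)"
| "rename_rterm k r (AC t) = AC (rename_kterm k t)"

text \<open>Bound variables are renamed by the same maps as free ones. Variable capture is therefore
  excluded by taking the maps injective, and no fresh names have to be chosen at the
  quantifiers.\<close>

primrec rename_formula ::
  "(nat \<Rightarrow> nat) \<Rightarrow> (nat \<Rightarrow> nat) \<Rightarrow> (nat \<Rightarrow> nat) \<Rightarrow>
    ('f, 'p, 'h, 'q) formula \<Rightarrow> ('f, 'p, 'h, 'q) formula" where
  "rename_formula k g r (KEq s t) = KEq (rename_kterm k s) (rename_kterm k t)"
| "rename_formula k g r (GEq s t) = GEq (rename_gterm k g s) (rename_gterm k g t)"
| "rename_formula k g r (GLess s t) = GLess (rename_gterm k g s) (rename_gterm k g t)"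
| "rename_formula k g r (GRel p ts) = GRel p (map (rename_gterm k g) ts)"
| "rename_formula k g r (REq s t) = REq (rename_rterm k r s) (rename_rterm k r t)"
| "rename_formula k g r (RRel q ts) = RRel q (map (rename_rterm k r) ts)"
| "rename_formula k g r (Neg \<phi>) = Neg (rename_formula k g r \<phi>)"
| "rename_formula k g r (Conj \<phi> \<psi>) = Conj (rename_formula k g r \<phi>) (rename_formula k g r \<psi>)"
| "rename_formula k g r (KEx i \<phi>) = KEx (k i) (rename_formula k g r \<phi>)"
| "rename_formula k g r (GEx i \<phi>) = GEx (g i) (rename_formula k g r \<phi>)"
| "rename_formula k g r (REx i \<phi>) = REx (r i) (rename_formula k g r \<phi>)"

lemma wf_rename_gterm [simp]: "wf_gterm LG (rename_gterm k g t) = wf_gterm LG t"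
  by (induction t) (auto simp: list_all_iff)

lemma wf_rename_rterm [simp]: "wf_rterm LR (rename_rterm k r t) = wf_rterm LR t"
  by (induction t) (auto simp: list_all_iff)

lemma wf_rename_formula [simp]: "wf_formula LG LR (rename_formula k g r \<phi>) = wf_formula LG LR \<phi>"
  by (induction \<phi>) (auto simp: list_all_iff)

lemma eval_rename_kterm [simp]: "eval_kterm e (rename_kterm k t) = eval_kterm (e \<circ> k) t"
  by (induction t) auto

lemma eval_rename_gterm [simp]:
  "eval_gterm v LG e eg (rename_gterm k g t) = eval_gterm v LG (e \<circ> k) (eg \<circ> g) t"
  by (induction t) (simp_all add: comp_def cong: map_cong)

lemma eval_rename_rterm [simp]:
  "eval_rterm ac LR e er (rename_rterm k r t) = eval_rterm ac LR (e \<circ> k) (er \<circ> r) t"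
  by (induction t) (simp_all add: comp_def cong: map_cong)

text \<open>This is the quantifier step of the next lemma. Injectivity guarantees that the update at
  \<open>k i\<close> is seen through \<open>k\<close> at the index \<open>i\<close> alone.\<close>

lemma fun_upd_comp_inj: "inj k \<Longrightarrow> e(k i := x) \<circ> k = (e \<circ> k)(i := x)"
  by (auto simp: fun_eq_iff inj_eq)

lemma sat_rename_formula:
  assumes "inj k" "inj g" "inj r"
  shows "sat v ac LG LR (rename_formula k g r \<phi>) e eg er =
    sat v ac LG LR \<phi> (e \<circ> k) (eg \<circ> g) (er \<circ> r)"
  using assms
  by (induction \<phi> arbitrary: e eg er)
    (simp_all add: fun_upd_comp_inj cong: map_cong)

text \<open>Keeps the parameters of two formulas apart while fixing the common coordinates \<open>I\<close>.\<close>

lemma disjoint_embeddings: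
  fixes I :: "nat set"
  assumes "finite I"
  obtains k l :: "nat \<Rightarrow> nat" where
    "inj k" "inj l" "\<And>i. i \<in> I \<Longrightarrow> k i = i \<and> l i = i"
    "\<And>i. i \<notin> I \<Longrightarrow> k i \<notin> I \<and> l i \<notin> I" "range k \<inter> range l \<subseteq> I"
proof -
  \<comment> \<open>All numbers from \<open>M\<close> on avoid \<open>I\<close>. Indices outside
    \<open>I\<close> are sent there, by \<open>k\<close> to even offsets from \<open>M\<close> and
    by \<open>l\<close> to odd ones.\<close>
  obtain M where M: "\<And>i. i \<in> I \<Longrightarrow> i < M"
    using assms by (metis finite_nat_set_iff_bounded)
  define k where "k i = (if i \<in> I then i else M + 2 * i)" for i
  define l where "l i = (if i \<in> I then i else M + 2 * i + 1)" for i
  have fresh: "M + i \<notin> I" for i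
    using M[of "M + i"] by auto
  show thesis
  proof
    show "inj k" "inj l"
      using fresh[of "2 * _"] fresh[of "Suc (2 * _)"] by (auto simp: inj_def k_def l_def)
    show "k i = i \<and> l i = i" if "i \<in> I" for i
      using that by (simp add: k_def l_def)
    show "k i \<notin> I \<and> l i \<notin> I" if "i \<notin> I" for i
      using that fresh[of "2 * i"] fresh[of "Suc (2 * i)"] by (simp add: k_def l_def)
    have "M + 2 * i \<noteq> M + 2 * j + 1" for i j by presburger
    then show "range k \<inter> range l \<subseteq> I"
      by (auto simp: k_def l_def split: if_splits)
  qed
qed

text \<open>Two parameter assignments merge into one because \<open>k\<close> and \<open>l\<close>
  collide only on \<open>I\<close>, where the coordinates of the point override the parameters
  anyway.\<close>

lemma override_on_amalgamate:
  fixes e\<^sub>1 e\<^sub>2 :: "nat \<Rightarrow> 'b"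
  assumes "inj k" "inj l" and fixed: "\<And>i. i \<in> I \<Longrightarrow> k i = i \<and> l i = i"
    and out: "\<And>i. i \<notin> I \<Longrightarrow> k i \<notin> I \<and> l i \<notin> I" and disj: "range k \<inter> range l \<subseteq> I"
  obtains e where "\<And>x. override_on e x I \<circ> k = override_on e\<^sub>1 x I"
    "\<And>x. override_on e x I \<circ> l = override_on e\<^sub>2 x I"
proof -
  define e where "e m = (if m \<in> range k then e\<^sub>1 (inv k m) else e\<^sub>2 (inv l m))" for m
  \<comment> \<open>Hence the first branch of \<open>e\<close> never intercepts a value meant for
    \<open>e\<^sub>2\<close>.\<close>
  have "l i \<notin> range k" if "i \<notin> I" for i
    using out[OF that] disj by blast
  then have "e (k i) = e\<^sub>1 i" "i \<notin> I \<Longrightarrow> e (l i) = e\<^sub>2 i" for i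
    using assms(1,2) by (auto simp: e_def)
  then show thesis
    using fixed out by (intro that[of e]) (auto simp: fun_eq_iff override_on_def)
qed

section \<open>Definable sets\<close>

lemma definable_subset_PiE: "definable v ac LG LR I A \<Longrightarrow> A \<subseteq> I \<rightarrow>\<^sub>E UNIV"
  by (auto simp: definable_def)

text \<open>The two formulas may use the same variable for different parameters, so they are renamed
  apart before being conjoined.\<close>

lemma definable_Int:
  assumes "finite I" "definable v ac LG LR I A" "definable v ac LG LR I B"
  shows "definable v ac LG LR I (A \<inter> B)"
proof -
  obtain \<phi> e\<^sub>1 eg\<^sub>1 er\<^sub>1 where \<phi>: "wf_formula LG LR \<phi>"
      "A = {x \<in> I \<rightarrow>\<^sub>E UNIV. sat v ac LG LR \<phi> (override_on e\<^sub>1 x I) eg\<^sub>1 er\<^sub>1}"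
    using assms(2) unfolding definable_def by blast
  obtain \<psi> e\<^sub>2 eg\<^sub>2 er\<^sub>2 where \<psi>: "wf_formula LG LR \<psi>"
      "B = {x \<in> I \<rightarrow>\<^sub>E UNIV. sat v ac LG LR \<psi> (override_on e\<^sub>2 x I) eg\<^sub>2 er\<^sub>2}"
    using assms(3) unfolding definable_def by blast
  obtain k l where kl: "inj k" "inj l" "\<And>i. i \<in> I \<Longrightarrow> k i = i \<and> l i = i"
      "\<And>i. i \<notin> I \<Longrightarrow> k i \<notin> I \<and> l i \<notin> I" "range k \<inter> range l \<subseteq> I"
    using disjoint_embeddings[OF assms(1)] by metis
  \<comment> \<open>The value group and residue sorts carry only parameters and no coordinates, so
    here the ranges can be fully disjoint. One pair of embeddings serves both sorts.\<close>
  obtain g h :: "nat \<Rightarrow> nat" where gh: "inj g" "inj h" "range g \<inter> range h \<subseteq> {}"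
    by (rule disjoint_embeddings[of "{}"]) simp
  obtain e where e: "\<And>x. override_on e x I \<circ> k = override_on e\<^sub>1 x I"
      "\<And>x. override_on e x I \<circ> l = override_on e\<^sub>2 x I"
    using override_on_amalgamate[OF kl] by metis
  obtain eg where eg: "eg \<circ> g = eg\<^sub>1" "eg \<circ> h = eg\<^sub>2"
    using override_on_amalgamate[of g h "{}" eg\<^sub>1 eg\<^sub>2] gh by auto
  obtain er where er: "er \<circ> g = er\<^sub>1" "er \<circ> h = er\<^sub>2"
    using override_on_amalgamate[of g h "{}" er\<^sub>1 er\<^sub>2] gh by auto
  let ?\<chi> = "Conj (rename_formula k g g \<phi>) (rename_formula l h h \<psi>)"
  have "A \<inter> B = {x \<in> I \<rightarrow>\<^sub>E UNIV. sat v ac LG LR ?\<chi> (override_on e x I) eg er}"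
    using kl gh by (auto simp: \<phi>(2) \<psi>(2) sat_rename_formula e eg er)
  then show ?thesis
    using \<phi>(1) \<psi>(1) unfolding definable_def
    by (intro exI[of _ ?\<chi>] exI[of _ e] exI[of _ eg] exI[of _ er]) simp
qed

lemma definable_val_diff_le:
  assumes "finite I" "i \<in> I" "j \<in> I"
  shows "definable v ac LG LR I {x \<in> I \<rightarrow>\<^sub>E UNIV. v (x i - b) \<le> v (x j - c)}"
proof -
  \<comment> \<open>The constants \<open>b\<close> and \<open>c\<close> enter as parameters, held by
    two distinct variables \<open>p\<close> and \<open>q\<close> outside \<open>I\<close>.\<close>
  obtain p where p: "p \<notin> I"
    using assms(1) by (rule ex_new_if_finite[OF infinite_UNIV_nat, THEN exE])
  obtain q where q: "q \<notin> insert p I"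
    using assms(1) by (meson ex_new_if_finite finite_insert infinite_UNIV_nat)
  let ?t = "\<lambda>i p. Val (KAdd (KVar i) (KNeg (KVar p)))"
  \<comment> \<open>The language offers only the strict order, so \<le> is the negated reverse
    inequality.\<close>
  let ?\<phi> = "Neg (GLess (?t j q) (?t i p))"
  show ?thesis
    unfolding definable_def
    by (rule exI[of _ ?\<phi>], rule exI[of _ "\<lambda>m. if m = p then b else c"])
      (use p q assms in \<open>auto simp: override_on_def not_less\<close>)
qed

lemma definable_Collect_Ball:
  assumes "finite I" "finite J" "definable v ac LG LR I A"
    and "\<And>j. j \<in> J \<Longrightarrow> definable v ac LG LR I {x \<in> I \<rightarrow>\<^sub>E UNIV. P j x}"
  shows "definable v ac LG LR I {x \<in> A. \<forall>j\<in>J. P j x}"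
  using assms(2,4)
proof (induction J rule: finite_induct)
  case empty
  then show ?case using assms(3) by simp
next
  case (insert j J)
  have "{x \<in> A. \<forall>j\<in>insert j J. P j x} = {x \<in> A. \<forall>j\<in>J. P j x} \<inter> {x \<in> I \<rightarrow>\<^sub>E UNIV. P j x}"
    using definable_subset_PiE[OF assms(3)] by auto
  then show ?case
    using insert.IH insert.prems by (simp only: definable_Int[OF assms(1)] insert_iff simp_thms)
qed

text \<open>A point \<open>y\<close> lies in the image exactly when
  \<open>y \<circ> inv \<sigma>\<close> lies in \<open>A\<close>, so renaming by
  \<open>inv \<sigma>\<close> turns a formula for \<open>A\<close> into one for the image.\<close>

lemma definable_permute:
  assumes \<sigma>: "\<sigma> permutes I" and A: "definable v ac LG LR I A"
  shows "definable v ac LG LR I ((\<lambda>x. x \<circ> \<sigma>) ` A)"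
proof -
  obtain \<phi> e eg er where \<phi>: "wf_formula LG LR \<phi>"
      "A = {x \<in> I \<rightarrow>\<^sub>E UNIV. sat v ac LG LR \<phi> (override_on e x I) eg er}"
    using A unfolding definable_def by blast
  have ext: "x \<circ> \<tau> \<in> I \<rightarrow>\<^sub>E UNIV" if "x \<in> I \<rightarrow>\<^sub>E UNIV" "\<tau> permutes I" for x :: "nat \<Rightarrow> 'a" and \<tau>
    using that by (auto simp: PiE_def extensional_def permutes_in_image)
  \<comment> \<open>The permutation fixes every index outside \<open>I\<close>, hence leaves the
    parameters in place.\<close>
  have override: "override_on e y I \<circ> inv \<sigma> = override_on e (y \<circ> inv \<sigma>) I" for y
    using permutes_inv[OF \<sigma>]
    by (auto simp: fun_eq_iff override_on_def permutes_in_image permutes_not_in)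
  have cancel: "x \<circ> \<sigma> \<circ> inv \<sigma> = x" "x \<circ> inv \<sigma> \<circ> \<sigma> = x" for x :: "nat \<Rightarrow> 'a"
    using permutes_inv_o[OF \<sigma>] by (simp_all add: comp_assoc)
  let ?\<psi> = "rename_formula (inv \<sigma>) id id \<phi>"
  have image: "y \<in> (\<lambda>x. x \<circ> \<sigma>) ` A \<longleftrightarrow> y \<in> I \<rightarrow>\<^sub>E UNIV \<and> y \<circ> inv \<sigma> \<in> A" for y
  proof
    assume "y \<in> (\<lambda>x. x \<circ> \<sigma>) ` A"
    then obtain x where x: "x \<in> A" "y = x \<circ> \<sigma>" by blast
    then have "x \<in> I \<rightarrow>\<^sub>E UNIV" using \<phi>(2) by blast
    with x show "y \<in> I \<rightarrow>\<^sub>E UNIV \<and> y \<circ> inv \<sigma> \<in> A"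
      using ext[OF _ \<sigma>] cancel(1) by metis
  next
    assume "y \<in> I \<rightarrow>\<^sub>E UNIV \<and> y \<circ> inv \<sigma> \<in> A"
    then show "y \<in> (\<lambda>x. x \<circ> \<sigma>) ` A" using cancel(2)[of y] by (metis image_eqI)
  qed
  have "sat v ac LG LR ?\<psi> (override_on e y I) eg er =
      sat v ac LG LR \<phi> (override_on e (y \<circ> inv \<sigma>) I) eg er" for y
    by (simp only: sat_rename_formula[OF permutes_inj[OF permutes_inv[OF \<sigma>]] inj_on_id inj_on_id]
        override comp_id)
  then have sat: "y \<circ> inv \<sigma> \<in> A \<longleftrightarrow> sat v ac LG LR ?\<psi> (override_on e y I) eg er"
    if "y \<in> I \<rightarrow>\<^sub>E UNIV" for y
    using ext[OF that permutes_inv[OF \<sigma>]] by (simp only: \<phi>(2) mem_Collect_eq simp_thms)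
  have "(\<lambda>x. x \<circ> \<sigma>) ` A =
      {y \<in> I \<rightarrow>\<^sub>E UNIV. sat v ac LG LR ?\<psi> (override_on e y I) eg er}"
    by (intro set_eqI) (simp only: image sat mem_Collect_eq cong: conj_cong)
  then show ?thesis
    using \<phi>(1) unfolding definable_def
    by (intro exI[of _ ?\<psi>] exI[of _ e] exI[of _ eg] exI[of _ er]) simp
qed

text \<open>Forgetting the coordinate \<open>i\<close> amounts to quantifying over it
  existentially.\<close>

lemma definable_project_insert:
  assumes A: "definable v ac LG LR (insert i J) A" and "i \<notin> J"
  shows "definable v ac LG LR J ((\<lambda>x. restrict x J) ` A)"
proof -
  obtain \<phi> e eg er where \<phi>: "wf_formula LG LR \<phi>"
      "A = {x \<in> insert i J \<rightarrow>\<^sub>E UNIV. sat v ac LG LR \<phi> (override_on e x (insert i J)) eg er}"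
    using A unfolding definable_def by blast
  \<comment> \<open>The witness of the quantifier takes the place of the forgotten coordinate. The
    value of \<open>e\<close> at \<open>i\<close> is overwritten on both sides.\<close>
  have override: "(override_on e (restrict x J) J)(i := y) = override_on e (x(i := y)) (insert i J)"
    for x and y :: 'a
    using \<open>i \<notin> J\<close> by (auto simp: fun_eq_iff override_on_def)
  have "(\<lambda>x. restrict x J) ` A =
      {x \<in> J \<rightarrow>\<^sub>E UNIV. sat v ac LG LR (KEx i \<phi>) (override_on e x J) eg er}" (is "?l = ?r")
  proof (intro equalityI subsetI)
    fix z assume "z \<in> ?l"
    then obtain x where x: "x \<in> A" "z = restrict x J" by blast
    then have "sat v ac LG LR \<phi> ((override_on e z J)(i := x i)) eg er"
      using override[of x "x i"] \<phi>(2) by simp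
    then show "z \<in> ?r" using x by auto
  next
    fix z assume z: "z \<in> ?r"
    then obtain y where "sat v ac LG LR \<phi> ((override_on e z J)(i := y)) eg er" by auto
    moreover have restr: "restrict z J = z" using z PiE_restrict by blast
    ultimately have "z(i := y) \<in> A"
      using override[of z y] z by (auto simp: \<phi>(2) PiE_def extensional_def)
    moreover have "restrict (z(i := y)) J = z"
      using restr \<open>i \<notin> J\<close> by (metis restrict_fupd)
    ultimately show "z \<in> ?l" by (metis image_eqI)
  qed
  then show ?thesis
    using \<phi>(1) unfolding definable_def
    by (intro exI[of _ "KEx i \<phi>"] exI[of _ e] exI[of _ eg] exI[of _ er]) simp
qed

lemma definable_project:
  assumes "finite D" "definable v ac LG LR (D \<union> J) A" "D \<inter> J = {}"
  shows "definable v ac LG LR J ((\<lambda>x. restrict x J) ` A)"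
  using assms
proof (induction D arbitrary: A rule: finite_induct)
  case empty
  then have "A \<subseteq> J \<rightarrow>\<^sub>E UNIV" using definable_subset_PiE by fastforce
  then have "(\<lambda>x. restrict x J) ` A = (\<lambda>x. x) ` A"
    by (intro image_cong) (auto simp: PiE_restrict)
  then show ?case using empty by (simp only: image_ident Un_empty_left)
next
  case (insert i D)
  have "definable v ac LG LR (D \<union> J) ((\<lambda>x. restrict x (D \<union> J)) ` A)"
    using insert by (intro definable_project_insert[of _ _ _ _ i]) auto
  then have "definable v ac LG LR J ((\<lambda>x. restrict x J) ` (\<lambda>x. restrict x (D \<union> J)) ` A)"
    using insert by (intro insert.IH) auto
  moreover have "restrict (restrict x (D \<union> J)) J = restrict x J" for x :: "nat \<Rightarrow> 'a"
    by (simp add: Int_absorb1)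
  ultimately show ?case
    by (simp only: image_image)
qed

section \<open>Accumulation points\<close>

lemma topspace_val_topology [simp]: "topspace (val_topology v) = UNIV"
  using openin_subset[of "val_topology v" UNIV] by (auto simp: openin_val_topology)

text \<open>By the ultrametric inequality, the ball of the same radius around any point of the ball
  is contained in it.\<close>

lemma (in valued_field) openin_val_ball: "openin (val_topology v) {t. Fin \<gamma> < v (t - c)}"
  unfolding openin_val_topology
proof
  fix x assume "x \<in> {t. Fin \<gamma> < v (t - c)}"
  then have "Fin \<gamma> < v (y - c)" if "Fin \<gamma> < v (y - x)" for y
    using that v_add[of "y - x" "x - c"] by (auto simp: min_def split: if_splits)
  then show "\<exists>\<delta>. {y. Fin \<delta> < v (y - x)} \<subseteq> {t. Fin \<gamma> < v (t - c)}"
    by blast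
qed

text \<open>Continuity pulls neighborhoods of \<open>f a\<close> back to neighborhoods of
  \<open>a\<close>, and injectivity keeps the points found there distinct from \<open>f a\<close>
  after mapping.\<close>

lemma derived_set_of_injective_image:
  assumes f: "continuous_map X Y f" "inj_on f (topspace X)" and a: "a \<in> X derived_set_of S"
  shows "f a \<in> Y derived_set_of (f ` S)"
  unfolding in_derived_set_of
proof (intro conjI allI impI)
  have aX: "a \<in> topspace X" using a by (simp add: in_derived_set_of)
  then show "f a \<in> topspace Y" using f(1) by (auto simp: continuous_map_def)
  fix T assume T: "f a \<in> T \<and> openin Y T"
  let ?W = "{x \<in> topspace X. f x \<in> T}"
  have "openin X ?W" using T f(1) by (simp add: openin_continuous_map_preimage)
  moreover have "a \<in> ?W" using T aX by simp
  ultimately have "\<exists>y. y \<noteq> a \<and> y \<in> S \<and> y \<in> ?W"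
    using a unfolding in_derived_set_of by meson
  then obtain y where "y \<noteq> a" "y \<in> S" "y \<in> topspace X" "f y \<in> T" by blast
  then show "\<exists>y. y \<noteq> f a \<and> y \<in> f ` S \<and> y \<in> T"
    using f(2) aX by (metis image_eqI inj_onD)
qed

lemma derived_set_of_permute:
  assumes \<sigma>: "\<sigma> permutes I" and a: "a \<in> affine_topology v I derived_set_of A"
  shows "a \<circ> \<sigma> \<in> affine_topology v I derived_set_of (\<lambda>x. x \<circ> \<sigma>) ` A"
proof (rule derived_set_of_injective_image[OF _ _ a])
  show "continuous_map (affine_topology v I) (affine_topology v I) (\<lambda>x. x \<circ> \<sigma>)"
    using \<sigma>
    by (auto simp: continuous_map_componentwise permutes_in_image extensional_def PiE_def
        intro!: continuous_map_product_projection)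
  show "inj_on (\<lambda>x. x \<circ> \<sigma>) (topspace (affine_topology v I))"
    by (rule inj_onI) (metis \<sigma> comp_assoc comp_id permutes_inv_o(1))
qed

text \<open>Finitely many sets cover \<open>A\<close> up to the point \<open>a\<close>, and forming
  derived sets commutes with finite unions. The farthest coordinate is the one whose difference has
  the least valuation.\<close>

lemma (in valued_field) accumulation_dominant_coordinate:
  assumes "finite I" "A \<subseteq> I \<rightarrow>\<^sub>E UNIV" and a: "a \<in> affine_topology v I derived_set_of A"
  obtains i where "i \<in> I"
    "a \<in> affine_topology v I derived_set_of {x \<in> A. \<forall>j\<in>I. v (x i - a i) \<le> v (x j - a j)}"
proof -
  define B where "B i = {x \<in> A. \<forall>j\<in>I. v (x i - a i) \<le> v (x j - a j)}" for i
  \<comment> \<open>Inserting \<open>a\<close> absorbs the case of empty \<open>I\<close>, in which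
    the union is empty and \<open>a\<close> is the only point of the space.\<close>
  have "x \<in> insert a (\<Union>i\<in>I. B i)" if "x \<in> A" for x
  proof (cases "I = {}")
    case True
    then show ?thesis using that assms(2) a by (auto simp: in_derived_set_of)
  next
    case False
    have fin: "finite ((\<lambda>i. v (x i - a i)) ` I)" using assms(1) by simp
    obtain i where i: "i \<in> I" "v (x i - a i) = Min ((\<lambda>i. v (x i - a i)) ` I)"
      using Min_in[OF fin] False by force
    then have "v (x i - a i) \<le> v (x j - a j)" if "j \<in> I" for j
      using that fin by simp
    then show ?thesis using i(1) \<open>x \<in> A\<close> by (auto simp: B_def)
  qed
  then have "affine_topology v I derived_set_of A \<subseteq>
      affine_topology v I derived_set_of ({a} \<union> (\<Union>i\<in>I. B i))"
    by (intro derived_set_of_mono) blast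
  moreover have "a \<notin> affine_topology v I derived_set_of {a}"
    by (metis in_derived_set_of openin_topspace singletonD)
  ultimately have "a \<in> affine_topology v I derived_set_of (\<Union>i\<in>I. B i)"
    using a unfolding derived_set_of_Un by blast
  then obtain i where "i \<in> I" "a \<in> affine_topology v I derived_set_of (B i)"
    using assms(1) by (auto simp: derived_set_of_Union)
  then show thesis using that by (simp add: B_def)
qed

section \<open>Fiber shrinking\<close>

text \<open>Dominance of the first coordinate is used twice: it forces the fibers to shrink as
  \<open>t\<close> tends to \<open>a 1\<close>, and it makes the projection of \<open>B\<close>
  accumulate at \<open>a 1\<close>.\<close>

lemma (in valued_field) fiber_shrinking_dominant_first_coordinate:
  assumes n: "1 \<le> n" and A: "definable v ac LG LR {1..n} A"
    and B_def: "B = {x \<in> A. \<forall>j\<in>{1..n}. v (x 1 - a 1) \<le> v (x j - a j)}"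
    and acc: "a \<in> affine_topology v {1..n} derived_set_of B"
  shows "fiber_shrinking v ac LG LR n A a ((\<lambda>x. x 1) ` B) (\<lambda>t. {y \<in> {2..n} \<rightarrow>\<^sub>E UNIV. y(1 := t) \<in> B})"
    (is "fiber_shrinking v ac LG LR n A a ?E ?\<Phi>")
proof -
  have BA: "B \<subseteq> A" by (auto simp: B_def)
  have B: "definable v ac LG LR {1..n} B"
    unfolding B_def using n by (intro definable_Collect_Ball A definable_val_diff_le) auto
  note Bsub = definable_subset_PiE[OF B]
  have split: "{1..n} = {2..n} \<union> {1}" using n by auto
  \<comment> \<open>Points are extensional functions, so removing the first coordinate and putting
    it back recovers the point. This identifies the total space of the family with
    \<open>B\<close>.\<close>
  have fib: "restrict x {2..n} \<in> ?\<Phi> (x 1)" "(restrict x {2..n})(1 := x 1) = x" if "x \<in> B" for x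
  proof -
    have "x \<in> {1..n} \<rightarrow>\<^sub>E UNIV" using Bsub that by blast
    then show "(restrict x {2..n})(1 := x 1) = x"
      by (fastforce simp: fun_eq_iff restrict_def PiE_def extensional_def)
    then show "restrict x {2..n} \<in> ?\<Phi> (x 1)" using that by simp
  qed
  have total: "family_total ?E ?\<Phi> = B"
  proof
    show "family_total ?E ?\<Phi> \<subseteq> B" by (auto simp: family_total_def)
    show "B \<subseteq> family_total ?E ?\<Phi>"
    proof
      fix x assume "x \<in> B"
      then have "x 1 \<in> ?E" by (rule imageI)
      moreover have "x \<in> (\<lambda>y. y(1 := x 1)) ` ?\<Phi> (x 1)"
        by (intro image_eqI[where x = "restrict x {2..n}"]) (simp_all only: fib[OF \<open>x \<in> B\<close>])
      ultimately show "x \<in> family_total ?E ?\<Phi>" unfolding family_total_def by (rule UN_I)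
    qed
  qed
  have "(\<lambda>t. \<lambda>i\<in>{1}. t) ` ?E = (\<lambda>x. restrict x {1}) ` B"
    unfolding image_image by (intro image_cong) (auto simp: restrict_def)
  moreover have "definable v ac LG LR {1} ((\<lambda>x. restrict x {1}) ` B)"
    using B unfolding split by (rule definable_project[rotated]) auto
  ultimately have line: "definable_line v ac LG LR ?E" by simp
  have aI: "a \<in> {1..n} \<rightarrow>\<^sub>E UNIV"
    using acc by (simp add: in_derived_set_of)
  \<comment> \<open>If the farthest coordinate agrees with that of \<open>a\<close>, its difference
    has valuation \<open>Infty\<close>, hence so have all the others and \<open>x\<close> is
    \<open>a\<close>.\<close>
  have first_neq: "x 1 \<noteq> a 1" if "x \<in> B" "x \<noteq> a" for x
  proof
    assume "x 1 = a 1"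
    then have "v (x 1 - a 1) = Infty" by (simp add: v_eq_Infty)
    then have "Infty \<le> v (x j - a j)" if "j \<in> {1..n}" for j
      using \<open>x \<in> B\<close> that unfolding B_def by (metis (lifting) mem_Collect_eq)
    then have eq: "x j = a j" if "j \<in> {1..n}" for j
      using that v_eq_Infty[of "x j - a j"] by (cases "v (x j - a j)") fastforce+
    have "x \<in> {1..n} \<rightarrow>\<^sub>E UNIV" using Bsub \<open>x \<in> B\<close> by blast
    then have "x = a" using aI eq by (rule PiE_ext)
    then show False using \<open>x \<noteq> a\<close> by simp
  qed
  have E: "a 1 \<in> val_topology v derived_set_of ?E"
    unfolding in_derived_set_of
  proof (intro conjI allI impI)
    fix T assume T: "a 1 \<in> T \<and> openin (val_topology v) T"
    let ?W = "{x \<in> topspace (affine_topology v {1..n}). x 1 \<in> T}"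
    have "openin (affine_topology v {1..n}) ?W"
      using T n by (intro openin_continuous_map_preimage[OF continuous_map_product_projection]) auto
    moreover have "a \<in> ?W" using T aI by simp
    ultimately have "\<exists>y. y \<noteq> a \<and> y \<in> B \<and> y \<in> ?W"
      using acc unfolding in_derived_set_of by meson
    then obtain y where "y \<noteq> a" "y \<in> B" "y 1 \<in> T" by blast
    then show "\<exists>t. t \<noteq> a 1 \<and> t \<in> ?E \<and> t \<in> T" using first_neq by blast
  qed simp
  have limit: "fiber_limit v {2..n} ?E ?\<Phi> (a 1) (restrict a {2..n})"
    unfolding fiber_limit_def
  proof (intro allI impI)
    fix U assume "openin (affine_topology v {2..n}) U \<and> restrict a {2..n} \<in> U"
    then have U: "openin (affine_topology v {2..n}) U" "restrict a {2..n} \<in> U" by auto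
    \<comment> \<open>Pass to a basic open box \<open>N\<close> inside \<open>U\<close>, then to a
      ball of radius \<open>\<gamma> i\<close> in each coordinate.\<close>
    from bspec[OF U(1)[unfolded openin_product_topology_alt] U(2)]
    obtain N where N: "\<And>i. i \<in> {2..n} \<Longrightarrow> openin (val_topology v) (N i)"
        "restrict a {2..n} \<in> Pi\<^sub>E {2..n} N" "Pi\<^sub>E {2..n} N \<subseteq> U"
      by blast
    have "\<exists>\<gamma>. \<forall>y. Fin \<gamma> < v (y - a i) \<longrightarrow> y \<in> N i" if "i \<in> {2..n}" for i
    proof -
      have "a i \<in> N i" using N(2) that by (auto simp: PiE_def Pi_def)
      then show ?thesis using N(1)[OF that] unfolding openin_val_topology by blast
    qed
    then obtain \<gamma> where \<gamma>: "\<And>i y. i \<in> {2..n} \<Longrightarrow> Fin (\<gamma> i) < v (y - a i) \<Longrightarrow> y \<in> N i"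
      by metis
    \<comment> \<open>One bound for all coordinates. The inserted 0 keeps the maximum meaningful for
      \<open>n = 1\<close>, when there are no further coordinates.\<close>
    define \<delta> where "\<delta> = Max (insert 0 (\<gamma> ` {2..n}))"
    have \<delta>: "\<gamma> i \<le> \<delta>" if "i \<in> {2..n}" for i
      unfolding \<delta>_def using that by (intro Max_ge) auto
    have "?\<Phi> t \<subseteq> U" if t: "Fin \<delta> < v (t - a 1)" for t
    proof
      fix y assume y: "y \<in> ?\<Phi> t"
      have "y i \<in> N i" if i: "i \<in> {2..n}" for i
      proof (rule \<gamma>[OF i])
        have "Fin (\<gamma> i) \<le> Fin \<delta>" using \<delta>[OF i] by simp
        also note t
        \<comment> \<open>This is the defining inequality of \<open>B\<close> at the point
          \<open>y(1 := t)\<close>, whose coordinate \<open>i\<close> is still \<open>y i\<close>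
          because \<open>i\<close> is at least 2.\<close>
        also have "v (t - a 1) \<le> v (y i - a i)"
          using y i n by (force simp: B_def)
        finally show "Fin (\<gamma> i) < v (y i - a i)" .
      qed
      then have "y \<in> Pi\<^sub>E {2..n} N" using y by (auto simp: PiE_def)
      then show "y \<in> U" using N(3) by blast
    qed
    moreover have "?\<Phi> t \<noteq> {}" if "t \<in> ?E" for t
      using that fib(1) by blast
    \<comment> \<open>So the center \<open>a 1\<close> belongs to the ball chosen as
      \<open>V\<close>.\<close>
    moreover have "v (a 1 - a 1) = Infty" by (simp add: v_eq_Infty)
    ultimately show "\<exists>V. openin (val_topology v) V \<and> a 1 \<in> V \<and>
        (\<forall>t\<in>V \<inter> ?E. t \<noteq> a 1 \<longrightarrow> ?\<Phi> t \<noteq> {} \<and> ?\<Phi> t \<subseteq> U)"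
      by (intro exI[of _ "{t. Fin \<delta> < v (t - a 1)}"]) (auto simp: openin_val_ball)
  qed
  have "a \<in> affine_topology v {1..n} derived_set_of A"
    using acc derived_set_of_mono[OF BA] by blast
  then show ?thesis
    unfolding fiber_shrinking_def total using A B BA line E limit by blast
qed

theorem proposition6p1:
  fixes v :: "'k::field \<Rightarrow> 'g::linordered_ab_group_add with_infty"
    and res ac :: "'k \<Rightarrow> 'r::field_char_0"
    and LG :: "('f, 'p, 'g with_infty) augmentation"
    and LR :: "('h, 'q, 'r) augmentation"
    and n :: nat
    and A :: "(nat \<Rightarrow> 'k) set"
    and a :: "nat \<Rightarrow> 'k"
  assumes "henselian_valued_field v res"
    and "angular_component v res ac"
    and "1 \<le> n"
    and "definable v ac LG LR {1..n} A"
    and "a \<in> affine_topology v {1..n} derived_set_of A"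
  shows "\<exists>\<sigma>. \<sigma> permutes {1..n} \<and>
    (\<exists>E \<Phi>. fiber_shrinking v ac LG LR n ((\<lambda>x. x \<circ> \<sigma>) ` A) (a \<circ> \<sigma>) E \<Phi>)"
proof -
  interpret henselian_valued_field v res by (rule assms(1))
  obtain i where i: "i \<in> {1..n}" and acc: "a \<in> affine_topology v {1..n} derived_set_of
      {x \<in> A. \<forall>j\<in>{1..n}. v (x i - a i) \<le> v (x j - a j)}"
    using accumulation_dominant_coordinate[OF _ definable_subset_PiE[OF assms(4)] assms(5)] by auto
  define \<sigma> where "\<sigma> = transpose 1 i"
  have \<sigma>: "\<sigma> permutes {1..n}"
    unfolding \<sigma>_def using i assms(3) by (intro permutes_swap_id) auto
  have \<sigma>1: "\<sigma> 1 = i" by (simp add: \<sigma>_def)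
  \<comment> \<open>Only the order of the inequalities changes, since \<sigma> maps the index set
    onto itself.\<close>
  have perm: "(\<forall>j\<in>{1..n}. v (x i - a i) \<le> v (x (\<sigma> j) - a (\<sigma> j))) \<longleftrightarrow>
      (\<forall>j\<in>{1..n}. v (x i - a i) \<le> v (x j - a j))" for x
    using permutes_image[OF \<sigma>] by (metis (no_types, lifting) imageE imageI)
  \<comment> \<open>After the exchange the dominant coordinate \<open>i\<close> has become the first
    one, relative to the permuted set and the permuted point.\<close>
  have image: "(\<lambda>x. x \<circ> \<sigma>) ` {x \<in> A. \<forall>j\<in>{1..n}. v (x i - a i) \<le> v (x j - a j)} =
    {x \<in> (\<lambda>x. x \<circ> \<sigma>) ` A. \<forall>j\<in>{1..n}. v (x 1 - (a \<circ> \<sigma>) 1) \<le> v (x j - (a \<circ> \<sigma>) j)}"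
    by (simp only: Compr_image_eq comp_apply \<sigma>1 perm)
  show ?thesis
    using fiber_shrinking_dominant_first_coordinate[OF assms(3) definable_permute[OF \<sigma> assms(4)]
        image derived_set_of_permute[OF \<sigma> acc]] \<sigma>
    by blast
qed

end
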